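(* Let $H$ be a reduced commutative monoid. 1. For a subset $A\subset\mathcal A(H)$ the following statements are equivalent: (a) $H$ is atomic and $A=\mathcal A(H)$. (b) $A$ is the smallest generating set of $H$ (with respect to set inclusion). (c) $A$ is a minimal generating set of $H$. 2. $H$ is finitely generated if and only if $H$ is atomic and $\mathcal A(H)$ is finite. 3. Suppose that $H$ is finitely generated. Then $H$ is a BF-monoid with finite set of distances $\Delta(H)$ and finite elasticity $\rho(H)$. Moreover, there is an $L\in\mathcal L(H)$ such that $\rho(L)=\rho(H)$, and there is an $M\in\mathbb N$ such that $\rho_k(H)-\rho_{k-1}(H)\le M$ for all $k\ge2$.
   Context: $\mathbb N$ is the set of positive integers, $\mathbb N_0=\mathbb N\cup\{0\}$. A monoid is a cancelative semigroup with identity; $H^\times$ is its group of invertible elements; $H$ is reduced if $H^\times=\{1\}$. An atom is an element $a\in H\setminus H^\times$ such that $a=uv$ with $u,v\in H$ implies $u\in H^\times$ or $v\in H^\times$; $\mathcal A(H)$ is the set of atoms. $H$ is atomic if every element of $H\setminus H^\times$ is a finite product of atoms. Generating sets are meant as generating sets of $H$ as a monoid. For $a\in H\setminus H^\times$, $\mathsf L(a)=\{k\in\mathbb N\mid a\text{ is a product of }k\text{ atoms}\}$; $\mathsf L(a)=\{0\}$ for $a\in H^\times$. $\mathcal L(H)=\{\mathsf L(a)\mid a\in H\}$. $H$ is a BF-monoid if $\mathsf L(a)$ is finite and nonempty for all $a\in H$. For $L\subset\mathbb Z$, $\Delta(L)$ is the set of all $d\in\mathbb N$ for which there are $k,\ell\in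 L$ with $\ell-k=d$ and no element of $L$ strictly between $k$ and $\ell$; $\Delta(H)=\bigcup_{L\in\mathcal L(H)}\Delta(L)$. For nonempty $L\subset\mathbb N$, $\rho(L)=\sup L/\min L$, and $\rho(\{0\})=1$; $\rho(H)=\sup\{\rho(L)\mid L\in\mathcal L(H)\}$. If $H\ne H^\times$, $\mathcal U_k(H)$ (for $k\in\mathbb N$) is the set of all $\ell\in\mathbb N$ such that there are atoms with $u_1\cdots u_k=v_1\cdots v_\ell$; if $H=H^\times$, $\mathcal U_k(H)=\{k\}$. $\rho_k(H)=\sup\mathcal U_k(H)$. *)

theory Defs
  imports "HOL-Algebra.Divisibility" "HOL-Library.Extended_Real"
begin

text \<open>
  A monoid, in the sense of factorization theory, is a cancellative semigroup with identity.
  The commutative ones are the instances of the library locale \<^locale>\<open>comm_monoid_cancel\<close>.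
\<close>

definition reduced :: "('a, 'b) monoid_scheme \<Rightarrow> bool" where
  "reduced H \<longleftrightarrow> Units H = {\<one>\<^bsub>H\<^esub>}"

definition atoms :: "('a, 'b) monoid_scheme \<Rightarrow> 'a set" where
  "atoms H = {a \<in> carrier H - Units H.
     \<forall>u \<in> carrier H. \<forall>v \<in> carrier H. a = u \<otimes>\<^bsub>H\<^esub> v \<longrightarrow> u \<in> Units H \<or> v \<in> Units H}"

definition list_prod :: "('a, 'b) monoid_scheme \<Rightarrow> 'a list \<Rightarrow> 'a" where
  "list_prod H xs = foldr (\<otimes>\<^bsub>H\<^esub>) xs \<one>\<^bsub>H\<^esub>"

definition atomic :: "('a, 'b) monoid_scheme \<Rightarrow> bool" where
  "atomic H \<longleftrightarrow>
     (\<forall>a \<in> carrier H - Units H. \<exists>us. set us \<subseteq> atoms H \<and> a = list_prod H us)"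

definition generates :: "('a, 'b) monoid_scheme \<Rightarrow> 'a set \<Rightarrow> bool" where
  "generates H A \<longleftrightarrow> A \<subseteq> carrier H \<and> (\<lambda>S. submonoid S H) hull A = carrier H"

definition smallest_generating_set :: "('a, 'b) monoid_scheme \<Rightarrow> 'a set \<Rightarrow> bool" where
  "smallest_generating_set H A \<longleftrightarrow> generates H A \<and> (\<forall>B. generates H B \<longrightarrow> A \<subseteq> B)"

definition minimal_generating_set :: "('a, 'b) monoid_scheme \<Rightarrow> 'a set \<Rightarrow> bool" where
  "minimal_generating_set H A \<longleftrightarrow> generates H A \<and> (\<forall>B. B \<subset> A \<longrightarrow> \<not> generates H B)"

definition finitely_generated :: "('a, 'b) monoid_scheme \<Rightarrow> bool" where
  "finitely_generated H \<longleftrightarrow> (\<exists>A. finite A \<and> generates H A)"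

definition length_set :: "('a, 'b) monoid_scheme \<Rightarrow> 'a \<Rightarrow> nat set" where
  "length_set H a =
     (if a \<in> Units H then {0}
      else {k. k \<ge> 1 \<and> (\<exists>us. length us = k \<and> set us \<subseteq> atoms H \<and> a = list_prod H us)})"

definition length_system :: "('a, 'b) monoid_scheme \<Rightarrow> nat set set" where
  "length_system H = length_set H ` carrier H"

definition BF_monoid :: "('a, 'b) monoid_scheme \<Rightarrow> bool" where
  "BF_monoid H \<longleftrightarrow> (\<forall>a \<in> carrier H. finite (length_set H a) \<and> length_set H a \<noteq> {})"

definition distances :: "int set \<Rightarrow> nat set" where
  "distances L =
     {d. d \<ge> 1 \<and> (\<exists>k \<in> L. \<exists>l \<in> L. l - k = int d \<and> \<not> (\<exists>m \<in> L. k < m \<and> m < l))}"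

definition set_of_distances :: "('a, 'b) monoid_scheme \<Rightarrow> nat set" where
  "set_of_distances H = (\<Union>L \<in> length_system H. distances (int ` L))"

text \<open>
  \<^term>\<open>Inf L\<close> on sets of naturals is the least element. The elasticity is meaningful for
  \<open>L = {0}\<close> and for nonempty sets of positive integers only; its value at the empty set,
  which is a set of lengths only if the monoid is not atomic, carries no meaning.
\<close>

definition elasticity_set :: "nat set \<Rightarrow> ereal" where
  "elasticity_set L =
     (if L = {0} then 1 else (SUP l \<in> L. ereal (real l)) / ereal (real (Inf L)))"

definition elasticity :: "('a, 'b) monoid_scheme \<Rightarrow> ereal" where
  "elasticity H = (SUP L \<in> length_system H. elasticity_set L)"

definition union_of_length_sets :: "('a, 'b) monoid_scheme \<Rightarrow> nat \<Rightarrow> nat set" where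
  "union_of_length_sets H k =
     (if carrier H = Units H then {k}
      else {l. l \<ge> 1 \<and> (\<exists>us vs. length us = k \<and> length vs = l \<and>
                 set us \<subseteq> atoms H \<and> set vs \<subseteq> atoms H \<and> list_prod H us = list_prod H vs)})"

text \<open>
  The values are extended reals so that differences are signed, not truncated. The library sets
  \<^prop>\<open>\<infinity> - \<infinity> = (\<infinity> :: ereal)\<close>, so a real upper bound on a difference of two such suprema is
  never satisfied by two infinite values.
\<close>

definition rho_k :: "('a, 'b) monoid_scheme \<Rightarrow> nat \<Rightarrow> ereal" where
  "rho_k H k = (SUP l \<in> union_of_length_sets H k. ereal (real l))"

end

theory Submission imports Defs begin

text \<open>
  The pairs \<open>(x, y)\<close> of factorizations of a common element form a submonoid of the square
  of the free commutative monoid on the atoms, and by cancellation it is closed under differences. If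
  there are only finitely many atoms, Dickson's lemma yields finitely many minimal nonempty pairs,
  and these generate it. A finitely generated monoid therefore inherits uniform bounds from this
  finite basis: the ratio \<open>|y| / |x|\<close> is maximal at a basis pair (elasticity), replacing one basis
  pair at a time moves from \<open>x\<close> to \<open>y\<close> through lengths with bounded gaps (distances), and a basis
  pair whose left side contains a given atom of \<open>x\<close> shows that removing this atom costs only
  boundedly much length on the other side (growth of \<open>\<rho>\<^sub>k\<close>).
\<close>

section \<open>Dickson's lemma\<close>

lemma mono_subseq_nat:
  fixes f :: "nat \<Rightarrow> nat"
  obtains s :: "nat \<Rightarrow> nat" where "strict_mono s" "mono (\<lambda>n. f (s n))"
proof -
  obtain t :: "nat \<Rightarrow> nat" where t: "strict_mono t" "monoseq (\<lambda>n. f (t n))"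
    using seq_monosub by blast
  show thesis
  proof (cases "\<forall>m. \<forall>n\<ge>m. f (t m) \<le> f (t n)")
    case True
    then show thesis using t(1) by (intro that[of t]) (auto simp: mono_def)
  next
    case False
    then have dec: "f (t n) \<le> f (t m)" if "m \<le> n" for m n
      using t(2) that unfolding monoseq_def by auto
    \<comment> \<open>A non-increasing sequence of naturals attains its minimum at some
      \<open>N\<close> and is constant from there on, so its tail is monotone in the wanted
      direction too.\<close>
    obtain N where N: "\<And>n. f (t N) \<le> f (t n)"
      using ex_has_least_nat[of "\<lambda>_. True" 0 "\<lambda>n. f (t n)"] by auto
    have "f (t (N + n)) = f (t N)" for n
      using N dec[of N "N + n"] by (simp add: antisym)
    moreover have "strict_mono (\<lambda>n. t (N + n))"
      using t(1) by (simp add: strict_mono_def)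
    ultimately show thesis
      by (intro that[of "\<lambda>n. t (N + n)"]) (auto simp: mono_def)
  qed
qed

text \<open>Repeated thinning: passing to a further subsequence for the index \<open>j\<close>
  preserves the monotonicity already reached for the indices in \<open>I\<close>.\<close>

lemma mono_common_subseq_nat:
  fixes f :: "'i \<Rightarrow> nat \<Rightarrow> nat"
  assumes "finite I"
  shows "\<exists>s :: nat \<Rightarrow> nat. strict_mono s \<and> (\<forall>i\<in>I. mono (\<lambda>n. f i (s n)))"
  using assms
proof induction
  case empty
  show ?case by (auto intro!: exI[of _ id] simp: strict_mono_def)
next
  case (insert j I)
  then obtain s :: "nat \<Rightarrow> nat" where s: "strict_mono s" "\<forall>i\<in>I. mono (\<lambda>n. f i (s n))"
    by blast
  obtain t :: "nat \<Rightarrow> nat" where t: "strict_mono t" "mono (\<lambda>n. f j (s (t n)))"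
    using mono_subseq_nat[of "\<lambda>n. f j (s n)"] by blast
  have "mono t" using t(1) by (rule strict_mono_mono)
  then have "\<forall>i\<in>insert j I. mono (\<lambda>n. f i (s (t n)))"
    using s(2) t(2) by (auto simp: mono_def)
  moreover have "strict_mono (\<lambda>n. s (t n))"
    using s(1) t(1) by (simp add: strict_mono_def)
  ultimately show ?case by blast
qed

text \<open>A pair of multisets over \<open>A\<close> is a vector of naturals with finitely many
  coordinates. An infinite antichain would contain an injective sequence, and a subsequence monotone
  in all coordinates would yield two distinct comparable members.\<close>

lemma finite_antichain_mset_pairs:
  assumes "finite A"
    and sub: "\<And>x y. (x, y) \<in> S \<Longrightarrow> set_mset x \<subseteq> A \<and> set_mset y \<subseteq> A"
    and anti: "\<And>x y x' y'. (x, y) \<in> S \<Longrightarrow> (x', y') \<in> S \<Longrightarrow> x \<subseteq># x' \<Longrightarrow> y \<subseteq># y' \<Longrightarrow> (x, y) = (x', y')"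
  shows "finite S"
proof (rule ccontr)
  assume "infinite S"
  then obtain r :: "nat \<Rightarrow> _" where r: "inj r" "range r \<subseteq> S"
    using infinite_countable_subset by blast
  \<comment> \<open>The coordinates are indexed by \<open>A \<times> UNIV\<close>; the Boolean
    selects the component, \<open>True\<close> for the first and \<open>False\<close> for the
    second.\<close>
  define f where "f i n = count (if snd i then fst (r n) else snd (r n)) (fst i)" for i n
  have "finite (A \<times> (UNIV :: bool set))" using assms(1) by simp
  from mono_common_subseq_nat[OF this, of f]
  obtain s :: "nat \<Rightarrow> nat" where s: "strict_mono s" "\<forall>i\<in>A \<times> UNIV. mono (\<lambda>n. f i (s n))" by blast
  have in_S: "(fst (r n), snd (r n)) \<in> S" for n using r(2) by auto
  have f_le: "f (a, b) (s 0) \<le> f (a, b) (s 1)" if "a \<in> A" for a b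
  proof -
    have "mono (\<lambda>n. f (a, b) (s n))" using s(2) that by blast
    then show ?thesis unfolding mono_def by simp
  qed
  have "fst (r (s 0)) \<subseteq># fst (r (s 1))"
    unfolding subseteq_mset_def
  proof
    fix a
    show "count (fst (r (s 0))) a \<le> count (fst (r (s 1))) a"
    proof (cases "a \<in> A")
      case True
      then show ?thesis using f_le[of a True] by (simp add: f_def)
    next
      case False
      then have "a \<notin># fst (r (s 0))" using sub[OF in_S, of "s 0"] by blast
      then show ?thesis by (simp add: not_in_iff)
    qed
  qed
  moreover have "snd (r (s 0)) \<subseteq># snd (r (s 1))"
    unfolding subseteq_mset_def
  proof
    fix a
    show "count (snd (r (s 0))) a \<le> count (snd (r (s 1))) a"
    proof (cases "a \<in> A")
      case True
      then show ?thesis using f_le[of a False] by (simp add: f_def)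
    next
      case False
      then have "a \<notin># snd (r (s 0))" using sub[OF in_S, of "s 0"] by blast
      then show ?thesis by (simp add: not_in_iff)
    qed
  qed
  ultimately have "r (s 0) = r (s 1)"
    using anti[OF in_S in_S, of "s 0" "s 1"] by (simp add: prod_eq_iff)
  then have "s 0 = s 1" using r(1) by (simp add: inj_eq)
  then show False using s(1) by (simp add: strict_mono_eq)
qed

text \<open>The minimal pairs of \<open>S\<close> form an antichain, hence a finite set. Descending
  from any pair of \<open>S\<close> to a smaller one lowers the total size, so the descent ends at a
  minimal pair.\<close>

lemma finite_minimal_mset_pairs:
  assumes "finite A"
    and "\<And>x y. (x, y) \<in> S \<Longrightarrow> set_mset x \<subseteq> A \<and> set_mset y \<subseteq> A"
  obtains B where "finite B" "B \<subseteq> S"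
    "\<And>x y. (x, y) \<in> S \<Longrightarrow> \<exists>p q. (p, q) \<in> B \<and> p \<subseteq># x \<and> q \<subseteq># y"
proof -
  define B where "B = {(p, q) \<in> S. \<forall>x y. (x, y) \<in> S \<longrightarrow> x \<subseteq># p \<longrightarrow> y \<subseteq># q \<longrightarrow> (x, y) = (p, q)}"
  have "B \<subseteq> S" by (auto simp: B_def)
  moreover have "finite B"
    using assms(1) by (rule finite_antichain_mset_pairs) (use assms(2) in \<open>auto simp: B_def\<close>)
  moreover have "\<exists>p q. (p, q) \<in> B \<and> p \<subseteq># x \<and> q \<subseteq># y" if "(x, y) \<in> S" for x y
    using that
  proof (induction "size x + size y" arbitrary: x y rule: less_induct)
    case less
    show ?case
    proof (cases "(x, y) \<in> B")
      case False
      then obtain x' y' where *: "(x', y') \<in> S" "x' \<subseteq># x" "y' \<subseteq># y" "(x', y') \<noteq> (x, y)"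
        using less.prems by (auto simp: B_def)
      then have "size x' + size y' < size x + size y"
        by (metis add_le_less_mono add_less_le_mono mset_subset_size size_mset_mono
            subset_mset.less_le)
      from less.hyps[OF this *(1)] * show ?thesis
        using subset_mset.order_trans by blast
    qed auto
  qed
  ultimately show thesis using that by blast
qed


text \<open>The submonoid generated by \<open>B\<close>, built by adding one pair of
  \<open>B\<close> at a time, so that its induction rule treats a relation as a succession of basis
  relations.\<close>

inductive_set mset_pair_span :: "('a multiset \<times> 'a multiset) set \<Rightarrow> ('a multiset \<times> 'a multiset) set"
  for B where
  empty: "({#}, {#}) \<in> mset_pair_span B"
| add: "(p, q) \<in> B \<Longrightarrow> (x, y) \<in> mset_pair_span B \<Longrightarrow> (p + x, q + y) \<in> mset_pair_span B"


section \<open>Generating sets and atoms\<close>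

text \<open>The chosen enumeration is immaterial for multisets over the carrier of a commutative
  monoid, see \<open>mset_prod_mset\<close>. This is then the canonical homomorphism from the free
  commutative monoid.\<close>

definition mset_prod :: "('a, 'b) monoid_scheme \<Rightarrow> 'a multiset \<Rightarrow> 'a" where
  "mset_prod H M = list_prod H (SOME xs. mset xs = M)"

lemma list_prod_simps [simp]:
  "list_prod H [] = \<one>\<^bsub>H\<^esub>"
  "list_prod H (x # xs) = x \<otimes>\<^bsub>H\<^esub> list_prod H xs"
  by (simp_all add: list_prod_def)

context comm_monoid
begin

lemma list_prod_closed [simp]: "set xs \<subseteq> carrier G \<Longrightarrow> list_prod G xs \<in> carrier G"
  unfolding list_prod_def by (rule multlist_closed)

lemma list_prod_append [simp]:
  "set xs \<subseteq> carrier G \<Longrightarrow> set ys \<subseteq> carrier G \<Longrightarrow>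
    list_prod G (xs @ ys) = list_prod G xs \<otimes> list_prod G ys"
  by (induction xs) (auto simp: m_assoc)

lemma list_prod_remove1:
  "set xs \<subseteq> carrier G \<Longrightarrow> a \<in> set xs \<Longrightarrow> list_prod G xs = a \<otimes> list_prod G (remove1 a xs)"
  unfolding list_prod_def using multlist_perm_cong[of xs "a # remove1 a xs"] by simp

lemma mset_prod_mset: "set xs \<subseteq> carrier G \<Longrightarrow> mset_prod G (mset xs) = list_prod G xs"
proof -
  assume xs: "set xs \<subseteq> carrier G"
  define ys where "ys = (SOME ys. mset ys = mset xs)"
  have ys: "mset ys = mset xs"
    unfolding ys_def by (rule someI[of "\<lambda>ys. mset ys = mset xs" xs]) (rule refl)
  then have "set ys \<subseteq> carrier G" using xs mset_eq_setD by metis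
  then have "list_prod G ys = list_prod G xs"
    unfolding list_prod_def using ys by (rule multlist_perm_cong[rotated])
  then show ?thesis by (simp add: mset_prod_def ys_def)
qed

lemma mset_prod_empty [simp]: "mset_prod G {#} = \<one>"
  using mset_prod_mset[of "[]"] by simp

lemma mset_prod_closed [simp]: "set_mset x \<subseteq> carrier G \<Longrightarrow> mset_prod G x \<in> carrier G"
  by (metis ex_mset list_prod_closed mset_prod_mset set_mset_mset)

lemma mset_prod_add_mset [simp]:
  assumes "a \<in> carrier G" "set_mset x \<subseteq> carrier G"
  shows "mset_prod G (add_mset a x) = a \<otimes> mset_prod G x"
proof -
  obtain xs where "mset xs = x" using ex_mset by blast
  then show ?thesis using assms mset_prod_mset[of "a # xs"] mset_prod_mset[of xs] by auto
qed

lemma mset_prod_union [simp]: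
  "set_mset x \<subseteq> carrier G \<Longrightarrow> set_mset y \<subseteq> carrier G \<Longrightarrow>
    mset_prod G (x + y) = mset_prod G x \<otimes> mset_prod G y"
  by (induction x) (auto simp: m_assoc)

text \<open>Products of lists over \<open>A\<close> are closed under multiplication by
  concatenation, the empty list supplies the identity, and every submonoid containing
  \<open>A\<close> contains these products.\<close>

lemma submonoid_hull_eq:
  assumes "A \<subseteq> carrier G"
  shows "(\<lambda>S. submonoid S G) hull A = list_prod G ` lists A"
proof (rule hull_unique)
  show "A \<subseteq> list_prod G ` lists A"
  proof
    fix a assume "a \<in> A"
    then show "a \<in> list_prod G ` lists A"
      using assms by (intro image_eqI[of _ _ "[a]"]) auto
  qed
  have sub: "set xs \<subseteq> carrier G" if "xs \<in> lists A" for xs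
    using that assms by auto
  show "submonoid (list_prod G ` lists A) G"
  proof
    show "list_prod G ` lists A \<subseteq> carrier G" using sub by (auto intro!: list_prod_closed)
    show "x \<otimes> y \<in> list_prod G ` lists A"
      if "x \<in> list_prod G ` lists A" "y \<in> list_prod G ` lists A" for x y
    proof -
      from that obtain xs ys where "xs \<in> lists A" "ys \<in> lists A"
        "x = list_prod G xs" "y = list_prod G ys" by blast
      then show ?thesis using sub by (intro image_eqI[of _ _ "xs @ ys"]) auto
    qed
    show "\<one> \<in> list_prod G ` lists A" by (intro image_eqI[of _ _ "[]"]) auto
  qed
  fix T assume T: "A \<subseteq> T" "submonoid T G"
  interpret T: submonoid T G by fact
  have "list_prod G xs \<in> T" if "set xs \<subseteq> A" for xs
    using that T(1) by (induction xs) auto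
  then show "list_prod G ` lists A \<subseteq> T" by (auto simp: lists_eq_set)
qed

lemma generates_iff:
  "generates G A \<longleftrightarrow>
    A \<subseteq> carrier G \<and> (\<forall>a\<in>carrier G. \<exists>us. set us \<subseteq> A \<and> a = list_prod G us)"
proof (cases "A \<subseteq> carrier G")
  case True
  then have "list_prod G ` lists A \<subseteq> carrier G"
    by (auto simp: lists_eq_set intro!: list_prod_closed)
  then show ?thesis
    using True unfolding generates_def submonoid_hull_eq[OF True] lists_eq_set by blast
qed (simp add: generates_def)

end

section \<open>Atoms and minimal generating sets of reduced monoids\<close>

locale reduced_comm_monoid = comm_monoid_cancel G for G (structure) +
  assumes reduced: "reduced G"
begin

lemma Units_eq: "Units G = {\<one>}"
  using reduced by (simp add: reduced_def)

lemma mult_eq_one_iff: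
  assumes "a \<in> carrier G" "b \<in> carrier G"
  shows "a \<otimes> b = \<one> \<longleftrightarrow> a = \<one> \<and> b = \<one>"
proof
  assume ab: "a \<otimes> b = \<one>"
  then have "b \<otimes> a = \<one>" using assms by (simp add: m_comm)
  with ab have "a \<in> Units G" "b \<in> Units G" using assms by (auto simp: Units_def)
  then show "a = \<one> \<and> b = \<one>" by (simp add: Units_eq)
qed simp

lemma atoms_subset: "atoms G \<subseteq> carrier G"
  by (auto simp: atoms_def)

lemma one_notin_atoms: "\<one> \<notin> atoms G"
  by (auto simp: atoms_def)

text \<open>Splitting off the head of the list, either the remaining product is
  \<open>\<one>\<close> and the head is the atom itself, or the head is \<open>\<one>\<close> and
  the search continues in the tail.\<close>

lemma atom_in_factors:
  assumes "a \<in> atoms G" "set us \<subseteq> carrier G" "a = list_prod G us"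
  shows "a \<in> set us"
  using assms(2,3)
proof (induction us)
  case Nil
  then show ?case using assms(1) one_notin_atoms by simp
next
  case (Cons u us)
  then have "u \<in> carrier G" "list_prod G us \<in> carrier G" by auto
  then have "u = \<one> \<or> list_prod G us = \<one>"
    using assms(1) Cons.prems(2) by (auto simp: atoms_def Units_eq)
  then show ?case using Cons by auto
qed

text \<open>An atom is a product over \<open>B\<close> and must occur among its own factors.\<close>

lemma atoms_subset_generating: "generates G B \<Longrightarrow> atoms G \<subseteq> B"
  using atom_in_factors atoms_subset unfolding generates_iff by (meson subset_iff)

lemma atomic_iff_generates_atoms: "atomic G \<longleftrightarrow> generates G (atoms G)"
proof
  assume at: "atomic G"
  have "\<exists>us. set us \<subseteq> atoms G \<and> a = list_prod G us" if "a \<in> carrier G" for a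
  proof (cases "a = \<one>")
    case True
    then show ?thesis by (intro exI[of _ "[]"]) simp
  next
    case False
    then show ?thesis using at that by (simp add: atomic_def Units_eq)
  qed
  then show "generates G (atoms G)" by (simp add: generates_iff atoms_subset)
qed (auto simp: generates_iff atomic_def)

lemma generates_subset_atoms_iff:
  assumes "A \<subseteq> atoms G"
  shows "generates G A \<longleftrightarrow> atomic G \<and> A = atoms G"
proof
  assume A: "generates G A"
  then have "A = atoms G" using assms atoms_subset_generating by (intro antisym)
  with A show "atomic G \<and> A = atoms G" by (simp add: atomic_iff_generates_atoms)
qed (simp add: atomic_iff_generates_atoms)

lemma smallest_generating_set_iff:
  assumes "A \<subseteq> atoms G"
  shows "smallest_generating_set G A \<longleftrightarrow> atomic G \<and> A = atoms G"
proof -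
  have "A \<subseteq> B" if "generates G B" for B
    using assms atoms_subset_generating[OF that] by (rule subset_trans)
  then show ?thesis
    by (simp add: smallest_generating_set_def generates_subset_atoms_iff[OF assms])
qed

text \<open>A proper subset of a set of atoms misses an atom and therefore cannot generate, so a
  generating set of atoms is automatically minimal.\<close>

lemma minimal_generating_set_iff:
  assumes "A \<subseteq> atoms G"
  shows "minimal_generating_set G A \<longleftrightarrow> atomic G \<and> A = atoms G"
proof -
  have "\<not> generates G B" if "B \<subset> A" for B
    using assms atoms_subset_generating[of B] that by auto
  then show ?thesis
    by (simp add: minimal_generating_set_def generates_subset_atoms_iff[OF assms])
qed

text \<open>By minimality \<open>a\<close> is not a product of other elements of \<open>A\<close>.
  If \<open>a = u \<otimes> v\<close>, then \<open>a\<close> must occur in an expansion of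
  \<open>u\<close> or of \<open>v\<close> over \<open>A\<close>, and cancelling \<open>a\<close>
  leaves \<open>\<one>\<close> for the other factor. This is needed for finite generation, where the
  generators are not known to be atoms.\<close>

lemma minimal_generating_set_subset_atoms:
  assumes "minimal_generating_set G A"
  shows "A \<subseteq> atoms G"
proof
  fix a assume a: "a \<in> A"
  have gen: "generates G A" using assms by (simp add: minimal_generating_set_def)
  then have A: "A \<subseteq> carrier G" by (simp add: generates_iff)
  have indispensable: False if us: "set us \<subseteq> A - {a}" "a = list_prod G us" for us
  proof -
    \<comment> \<open>Substituting \<open>us\<close> for each occurrence of \<open>a\<close> turns
      any product over \<open>A\<close> into one over \<open>A - {a}\<close>, which would then
      generate as well.\<close>
    have *: "\<exists>ws. set ws \<subseteq> A - {a} \<and> list_prod G vs = list_prod G ws" if "set vs \<subseteq> A" for vs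
      using that
    proof (induction vs)
      case Nil
      show ?case by (intro exI[of _ "[]"]) simp
    next
      case (Cons v vs)
      then obtain ws where ws: "set ws \<subseteq> A - {a}" "list_prod G vs = list_prod G ws" by auto
      show ?case
      proof (cases "v = a")
        case True
        then have "list_prod G (v # vs) = list_prod G us \<otimes> list_prod G ws"
          using us(2) ws(2) by simp
        also have "\<dots> = list_prod G (us @ ws)" using us(1) ws(1) A by (subst list_prod_append) auto
        finally show ?thesis using us(1) ws(1) by (intro exI[of _ "us @ ws"]) auto
      next
        case False
        then show ?thesis using Cons.prems ws by (intro exI[of _ "v # ws"]) auto
      qed
    qed
    then have "generates G (A - {a})"
      using gen unfolding generates_iff by (metis Diff_subset subset_trans)
    then show False using assms a unfolding minimal_generating_set_def by blast
  qed
  have "u = \<one> \<or> v = \<one>" if uv: "u \<in> carrier G" "v \<in> carrier G" "a = u \<otimes> v" for u v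
  proof -
    \<comment> \<open>As \<open>a\<close> occurs in \<open>xs\<close>, it divides \<open>x\<close>,
      say \<open>x = a \<otimes> z\<close>. Then \<open>a = a \<otimes> z \<otimes> y\<close>, so
      \<open>z \<otimes> y = \<one>\<close> by cancellation and \<open>y = \<one>\<close> by
      reducedness.\<close>
    have cofactor: "y = \<one>" if "set xs \<subseteq> A" "a \<in> set xs" "x = list_prod G xs"
        "y \<in> carrier G" "a = x \<otimes> y" for x y xs
    proof -
      define z where "z = list_prod G (remove1 a xs)"
      have z: "z \<in> carrier G" unfolding z_def using that A set_remove1_subset[of a xs]
        by (intro list_prod_closed) auto
      have ac: "a \<in> carrier G" using a A by auto
      have "x = a \<otimes> z" using that A unfolding z_def by (auto intro: list_prod_remove1)
      then have "a \<otimes> (z \<otimes> y) = x \<otimes> y" using that(4) z ac by (simp add: m_assoc)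
      then have "a \<otimes> (z \<otimes> y) = a \<otimes> \<one>" using that(5) ac by simp
      then have "z \<otimes> y = \<one>" using l_cancel[of a "z \<otimes> y" \<one>] z ac that by simp
      then show ?thesis using mult_eq_one_iff z that by simp
    qed
    obtain us vs where us: "set us \<subseteq> A" "u = list_prod G us" and vs: "set vs \<subseteq> A" "v = list_prod G vs"
      using gen uv(1,2) unfolding generates_iff by metis
    have "a = list_prod G (us @ vs)" using us vs A uv by (subst list_prod_append) auto
    then have "a \<in> set us \<or> a \<in> set vs" using indispensable[of "us @ vs"] us vs by auto
    moreover have "a = v \<otimes> u" using uv m_comm by simp
    ultimately show ?thesis using cofactor[of us u v] cofactor[of vs v u] us vs uv by blast
  qed
  \<comment> \<open>The empty product also avoids \<open>a\<close>.\<close>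
  moreover have "a \<noteq> \<one>" using indispensable[of "[]"] by auto
  ultimately show "a \<in> atoms G" using a A by (auto simp: atoms_def Units_eq)
qed

text \<open>A finite generating set of least cardinality has no generating proper subset, so it is
  minimal under inclusion and equals the set of atoms.\<close>

lemma finitely_generated_iff: "finitely_generated G \<longleftrightarrow> atomic G \<and> finite (atoms G)"
proof
  assume "finitely_generated G"
  then obtain A where A: "finite A" "generates G A" by (auto simp: finitely_generated_def)
  then obtain B where B: "finite B" "generates G B"
      "\<And>C. finite C \<and> generates G C \<Longrightarrow> card B \<le> card C"
    using ex_has_least_nat[of "\<lambda>A. finite A \<and> generates G A" A card] by auto
  have "\<not> generates G C" if "C \<subset> B" for C
    using B(3)[of C] psubset_card_mono[OF B(1) that] finite_subset[of C B] B(1) that by auto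
  then have "minimal_generating_set G B" using B(2) by (simp add: minimal_generating_set_def)
  then show "atomic G \<and> finite (atoms G)"
    using minimal_generating_set_subset_atoms minimal_generating_set_iff B(1) by blast
qed (auto simp: finitely_generated_def atomic_iff_generates_atoms)


section \<open>The monoid of relations\<close>

text \<open>Multisets disregard the order of the factors. Since the monoid is reduced, there are no
  associates to identify.\<close>

definition factorizations :: "'a \<Rightarrow> 'a multiset set" where
  "factorizations a = {x. set_mset x \<subseteq> atoms G \<and> mset_prod G x = a}"

text \<open>The kernel congruence of \<open>mset_prod\<close> on the free commutative monoid over
  the atoms, known as the monoid of relations.\<close>

definition relations :: "('a multiset \<times> 'a multiset) set" where
  "relations =
    {(x, y). set_mset x \<subseteq> atoms G \<and> set_mset y \<subseteq> atoms G \<and> mset_prod G x = mset_prod G y}"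

lemma mset_prod_eq_one_iff:
  assumes "set_mset x \<subseteq> atoms G"
  shows "mset_prod G x = \<one> \<longleftrightarrow> x = {#}"
proof (cases x)
  case (add a y)
  then have "a \<in> atoms G" "set_mset y \<subseteq> carrier G" using assms atoms_subset by auto
  then show ?thesis
    using add mult_eq_one_iff[of a "mset_prod G y"] one_notin_atoms atoms_subset by auto
qed simp

text \<open>Only the empty multiset of atoms has product \<open>\<one>\<close>. Hence both sides of
  a nonempty basis pair are nonempty, so its ratio of sizes has a positive denominator.\<close>

lemma relations_empty_iff: "(x, y) \<in> relations \<Longrightarrow> x = {#} \<longleftrightarrow> y = {#}"
  unfolding relations_def
  by clarify (metis mset_prod_eq_one_iff)

lemma relations_add:
  "(p, q) \<in> relations \<Longrightarrow> (x, y) \<in> relations \<Longrightarrow> (p + x, q + y) \<in> relations"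
  using atoms_subset by (auto simp: relations_def subset_iff)

lemma relations_refl: "set_mset x \<subseteq> atoms G \<Longrightarrow> (x, x) \<in> relations"
  by (simp add: relations_def)

text \<open>Cancelling the common value of \<open>p\<close> and \<open>q\<close> lets a smaller
  relation be split off from a larger one.\<close>

lemma relations_cancel:
  assumes "(p, q) \<in> relations" "(p + x, q + y) \<in> relations"
  shows "(x, y) \<in> relations"
proof -
  have at: "set_mset p \<subseteq> atoms G" "set_mset q \<subseteq> atoms G" "set_mset x \<subseteq> atoms G" "set_mset y \<subseteq> atoms G"
    using assms by (auto simp: relations_def)
  then have "mset_prod G p \<otimes> mset_prod G x = mset_prod G p \<otimes> mset_prod G y"
    using assms atoms_subset by (auto simp: relations_def)
  then have "mset_prod G x = mset_prod G y"
    by (rule l_cancel) (use at atoms_subset in auto)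
  then show ?thesis using at by (simp add: relations_def)
qed

section \<open>Lengths expressed by multisets of atoms\<close>

lemma relations_iff_factorizations:
  "(x, y) \<in> relations \<longleftrightarrow> (\<exists>a. x \<in> factorizations a \<and> y \<in> factorizations a)"
  by (auto simp: relations_def factorizations_def)

lemma ex_list_factorization_iff:
  "(\<exists>us. length us = k \<and> set us \<subseteq> atoms G \<and> a = list_prod G us) \<longleftrightarrow>
    (\<exists>x \<in> factorizations a. size x = k)" (is "?L \<longleftrightarrow> ?R")
proof
  assume ?L
  then obtain us where us: "length us = k" "set us \<subseteq> atoms G" "a = list_prod G us" by blast
  then have "mset us \<in> factorizations a"
    using atoms_subset by (simp add: factorizations_def mset_prod_mset)
  then show ?R by (intro bexI[of _ "mset us"]) (simp_all add: us(1))
next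
  assume ?R
  then obtain x where x: "x \<in> factorizations a" "size x = k" by blast
  obtain us where us: "mset us = x" using ex_mset by blast
  have "set us \<subseteq> atoms G" "length us = k" "a = list_prod G us"
    using x us atoms_subset mset_prod_mset[of us] by (auto simp: factorizations_def)
  then show ?L by blast
qed

text \<open>The separate value \<open>{0}\<close> at the identity fits in: its only factorization is
  empty. For any other element the empty multiset is excluded, which gives
  \<open>k \<ge> 1\<close>.\<close>

lemma length_set_eq:
  assumes "a \<in> carrier G"
  shows "length_set G a = size ` factorizations a"
proof (cases "a = \<one>")
  case True
  then have "factorizations a = {{#}}"
    using mset_prod_eq_one_iff by (auto simp: factorizations_def)
  then show ?thesis using True by (simp add: length_set_def)
next
  case False
  then have "size x \<ge> 1" if "x \<in> factorizations a" for x
    using that by (cases x) (auto simp: factorizations_def)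
  then show ?thesis
    using False unfolding length_set_def ex_list_factorization_iff by (auto simp: Units_eq)
qed

lemma union_of_length_sets_eq:
  assumes "carrier G \<noteq> {\<one>}"
  shows "union_of_length_sets G k = {size y | x y. (x, y) \<in> relations \<and> size x = k \<and> y \<noteq> {#}}"
proof -
  have "(\<exists>us vs. length us = k \<and> length vs = l \<and> set us \<subseteq> atoms G \<and> set vs \<subseteq> atoms G \<and>
      list_prod G us = list_prod G vs) \<longleftrightarrow> (\<exists>x y. (x, y) \<in> relations \<and> size x = k \<and> size y = l)" for l
  proof -
    \<comment> \<open>Naming the common product \<open>a\<close> decouples the two lists, so that
      each becomes a factorization of \<open>a\<close> separately.\<close>
    have "?thesis \<longleftrightarrow> (\<exists>a. (\<exists>us. length us = k \<and> set us \<subseteq> atoms G \<and> a = list_prod G us) \<and>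
        (\<exists>us. length us = l \<and> set us \<subseteq> atoms G \<and> a = list_prod G us)) =
        (\<exists>x y. (x, y) \<in> relations \<and> size x = k \<and> size y = l)"
      by (intro arg_cong2[of _ _ _ _ "(=)"]) auto
    then show ?thesis
      unfolding ex_list_factorization_iff relations_iff_factorizations by blast
  qed
  then have "union_of_length_sets G k =
      {l. l \<ge> 1 \<and> (\<exists>x y. (x, y) \<in> relations \<and> size x = k \<and> size y = l)}"
    using assms unfolding union_of_length_sets_def Units_eq by simp
  also have "\<dots> = {size y | x y. (x, y) \<in> relations \<and> size x = k \<and> y \<noteq> {#}}"
    unfolding nonempty_has_size Suc_le_eq One_nat_def by blast
  finally show ?thesis .
qed

text \<open>The basis consists of the finitely many minimal nonempty relations provided by Dickson's
  lemma. Subtracting one of them from a relation leaves a shorter relation, so induction on the size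
  of the left side shows that they generate.\<close>

lemma finite_relations_basis:
  assumes "finite (atoms G)"
  obtains B where "finite B" "B \<subseteq> relations - {({#}, {#})}" "mset_pair_span B = relations"
proof -
  obtain B where B: "finite B" "B \<subseteq> relations - {({#}, {#})}"
    "\<And>x y. (x, y) \<in> relations - {({#}, {#})} \<Longrightarrow> \<exists>p q. (p, q) \<in> B \<and> p \<subseteq># x \<and> q \<subseteq># y"
    using finite_minimal_mset_pairs[OF assms, of "relations - {({#}, {#})}"]
    by (auto simp: relations_def)
  have "(x, y) \<in> mset_pair_span B" if "(x, y) \<in> relations" for x y
    using that
  proof (induction "size x" arbitrary: x y rule: less_induct)
    case less
    show ?case
    proof (cases "x = {#}")
      case True
      then show ?thesis using mset_pair_span.empty relations_empty_iff[OF less.prems] by simp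
    next
      case False
      then obtain p q where pq: "(p, q) \<in> B" "p \<subseteq># x" "q \<subseteq># y"
        using B(3)[of x y] less.prems by auto
      then obtain x' y' where xy: "x = p + x'" "y = q + y'"
        unfolding mset_subset_eq_exists_conv by blast
      have "(p, q) \<in> relations" "(p, q) \<noteq> ({#}, {#})" using pq B(2) by auto
      then have "p \<noteq> {#}" using relations_empty_iff[of p q] by auto
      then have "size x' < size x" using xy nonempty_has_size[of p] by simp
      moreover have "(x', y') \<in> relations"
        using \<open>(p, q) \<in> relations\<close> less.prems[unfolded xy] by (rule relations_cancel)
      ultimately have "(x', y') \<in> mset_pair_span B" by (rule less.hyps)
      then show ?thesis unfolding xy by (rule mset_pair_span.add[OF pq(1)])
    qed
  qed
  moreover have "(x, y) \<in> relations" if "(x, y) \<in> mset_pair_span B" for x y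
    using that
  proof induction
    case empty
    show ?case by (simp add: relations_refl)
  next
    case (add p q x y)
    then show ?case using B(2) relations_add by blast
  qed
  ultimately have "mset_pair_span B = relations" by auto
  with B(1,2) show thesis using that by blast
qed

lemma finite_relations_basis_bounded:
  assumes "finite (atoms G)"
  obtains B M where "finite B" "mset_pair_span B = relations"
    "\<And>p q. (p, q) \<in> B \<Longrightarrow> (p, q) \<in> relations \<and> p \<noteq> {#} \<and> size q \<le> M"
proof -
  obtain B where B: "finite B" "B \<subseteq> relations - {({#}, {#})}" "mset_pair_span B = relations"
    using finite_relations_basis[OF assms] by blast
  obtain M where "\<forall>n \<in> (\<lambda>(p, q). size q) ` B. n \<le> M"
    using B(1) finite_nat_set_iff_bounded_le[of "(\<lambda>(p, q). size q) ` B"] by blast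
  then have "(p, q) \<in> relations \<and> p \<noteq> {#} \<and> size q \<le> M" if "(p, q) \<in> B" for p q
    using that B(2) relations_empty_iff[of p q] by fastforce
  with B(1,3) show thesis using that by blast
qed

lemma relations_size_bound:
  assumes "finite (atoms G)"
  obtains M where "\<And>x y. (x, y) \<in> relations \<Longrightarrow> size y \<le> M * size x"
proof -
  obtain B M where fin: "finite B" and span: "mset_pair_span B = relations"
    and B: "\<And>p q. (p, q) \<in> B \<Longrightarrow> (p, q) \<in> relations \<and> p \<noteq> {#} \<and> size q \<le> M"
    using finite_relations_basis_bounded[OF assms] by blast
  \<comment> \<open>With the span rewritten to \<open>relations\<close>, rule induction proves
    statements about all relations by adding one basis pair at a time.\<close>
  note ind = mset_pair_span.induct[where B = B, unfolded span]
  have "size y \<le> M * size x" if "(x, y) \<in> relations" for x y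
    using that
  proof (rule ind)
    fix p q x y :: "'a multiset"
    assume *: "(p, q) \<in> B" "size y \<le> M * size x"
    then have "size q \<le> M" "1 \<le> size p" using B[of p q] by (auto simp: Suc_le_eq nonempty_has_size)
    \<comment> \<open>Nonemptiness of \<open>p\<close> absorbs the constant bound \<open>M\<close>
      into a multiple of \<open>size p\<close>; linear bounds of this kind are additive.\<close>
    then have "size q \<le> M * size p" using mult_le_mono[of "size q" M 1 "size p"] by simp
    then show "size (q + y) \<le> M * size (p + x)" using * by (simp add: algebra_simps)
  qed simp
  then show thesis using that by blast
qed

text \<open>The quotient of two sums is at most the largest of the termwise quotients, so the
  maximum over the finite basis bounds all relations.\<close>

lemma relations_maximal_ratio:
  assumes "finite (atoms G)" "atoms G \<noteq> {}"
  obtains p q where "(p, q) \<in> relations" "p \<noteq> {#}"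
    "\<And>x y. (x, y) \<in> relations \<Longrightarrow> real (size y) \<le> real (size q) / real (size p) * real (size x)"
proof -
  obtain B M where fin: "finite B" and span: "mset_pair_span B = relations"
    and B: "\<And>p q. (p, q) \<in> B \<Longrightarrow> (p, q) \<in> relations \<and> p \<noteq> {#} \<and> size q \<le> M"
    using finite_relations_basis_bounded[OF assms(1)] by blast
  note ind = mset_pair_span.induct[where B = B, unfolded span]
  obtain u where "u \<in> atoms G" using assms(2) by blast
  \<comment> \<open>The trivial relation of an atom with itself is nonempty, so \<open>Max\<close>
    is taken over a nonempty set.\<close>
  have "B \<noteq> {}"
  proof
    assume "B = {}"
    have "({#u#}, {#u#}) \<in> relations" using \<open>u \<in> atoms G\<close> by (simp add: relations_refl)
    then have "{#u#} = {#}"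
      by (rule ind[where P = "\<lambda>x y. x = {#}"]) (use \<open>B = {}\<close> in auto)
    then show False by simp
  qed
  define ratio where "ratio b = real (size (snd b)) / real (size (fst b))"
    for b :: "'a multiset \<times> 'a multiset"
  have "Max (ratio ` B) \<in> ratio ` B" using fin \<open>B \<noteq> {}\<close> by simp
  then obtain p q where pq: "(p, q) \<in> B" "ratio (p, q) = Max (ratio ` B)" by fastforce
  have "real (size y) \<le> ratio (p, q) * real (size x)" if "(x, y) \<in> relations" for x y
    using that
  proof (rule ind)
    fix p' q' x y :: "'a multiset"
    assume *: "(p', q') \<in> B" "real (size y) \<le> ratio (p, q) * real (size x)"
    have "ratio (p', q') \<le> ratio (p, q)" using pq(2) * fin by simp
    moreover have "0 < real (size p')" using B[OF *(1)] by (simp add: nonempty_has_size[symmetric])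
    ultimately have "real (size q') \<le> ratio (p, q) * real (size p')"
      by (simp add: ratio_def pos_divide_le_eq)
    then show "real (size (q' + y)) \<le> ratio (p, q) * real (size (p' + x))"
      using * by (simp add: distrib_left)
  qed simp
  with B[OF pq(1)] show thesis by (intro that) (auto simp: ratio_def)
qed

text \<open>
  The step from \<open>x\<close> to \<open>y\<close> is split into replacements of one basis relation at a time. Each of
  them raises the length by at most \<open>M\<close>, so no window of \<open>M\<close> consecutive lengths is skipped.
\<close>

lemma relations_intermediate_length:
  assumes "finite (atoms G)"
  obtains M where "\<And>x y t. (x, y) \<in> relations \<Longrightarrow> size x \<le> t \<Longrightarrow> t < size y \<Longrightarrow>
    \<exists>w. (x, w) \<in> relations \<and> t < size w \<and> size w \<le> t + M"
proof -
  obtain B M where fin: "finite B" and span: "mset_pair_span B = relations"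
    and B: "\<And>p q. (p, q) \<in> B \<Longrightarrow> (p, q) \<in> relations \<and> p \<noteq> {#} \<and> size q \<le> M"
    using finite_relations_basis_bounded[OF assms] by blast
  note ind = mset_pair_span.induct[where B = B, unfolded span]
  \<comment> \<open>The common part \<open>z\<close> carries the atoms not taking part in the
    current replacement; in the induction step it grows by \<open>q\<close>.\<close>
  define P where "P x y \<longleftrightarrow> (\<forall>z t. set_mset z \<subseteq> atoms G \<longrightarrow> size (x + z) \<le> t \<longrightarrow> t < size (y + z) \<longrightarrow>
      (\<exists>w. (x + z, w) \<in> relations \<and> t < size w \<and> size w \<le> t + M))" for x y
  have P: "P x y" if "(x, y) \<in> relations" for x y
    using that
  proof (rule ind)
    fix p q x y :: "'a multiset"
    assume *: "(p, q) \<in> B" "(x, y) \<in> relations" "P x y"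
    have pq: "(p, q) \<in> relations" "size q \<le> M" using B[OF *(1)] by auto
    show "P (p + x) (q + y)"
      unfolding P_def
    proof (intro allI impI)
      fix z t
      assume z: "set_mset z \<subseteq> atoms G" and t: "size (p + x + z) \<le> t" "t < size (q + y + z)"
      have xz: "set_mset (x + z) \<subseteq> atoms G" and qz: "set_mset (q + z) \<subseteq> atoms G"
        using z *(2) pq(1) by (auto simp: relations_def)
      have swap: "(p + (x + z), q + (x + z)) \<in> relations"
        using pq(1) relations_refl[OF xz] by (rule relations_add)
      show "\<exists>w. (p + x + z, w) \<in> relations \<and> t < size w \<and> size w \<le> t + M"
      \<comment> \<open>If replacing \<open>p\<close> by \<open>q\<close> already passes
        \<open>t\<close>, it overshoots by at most \<open>size q \<le> M\<close>. Otherwise the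
        length is still at most \<open>t\<close>, and the induction hypothesis applies with
        \<open>q + z\<close> as common part.\<close>
      proof (cases "t < size (q + (x + z))")
        case True
        then show ?thesis
          using swap t(1) pq(2) by (intro exI[of _ "q + (x + z)"]) (simp add: add.assoc)
      next
        case False
        then have "size (x + (q + z)) \<le> t" "t < size (y + (q + z))" using t by auto
        then obtain w where w: "(x + (q + z), w) \<in> relations" "t < size w" "size w \<le> t + M"
          using *(3) qz unfolding P_def by blast
        have "(p + x + z, w) \<in> relations"
          using swap w(1) by (auto simp: relations_def ac_simps)
        then show ?thesis using w by blast
      qed
    qed
  qed (simp add: P_def)
  show thesis
  proof (rule that)
    fix x y t assume "(x, y) \<in> relations" "size x \<le> t" "t < size y"
    then show "\<exists>w. (x, w) \<in> relations \<and> t < size w \<and> size w \<le> t + M"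
      using P[of x y] unfolding P_def by (metis add.right_neutral empty_subsetI set_mset_empty)
  qed
qed

text \<open>If \<open>u\<close> lies in the left side \<open>p\<close> of the basis pair just added,
  then \<open>q\<close> is given up and the rest of \<open>p\<close> is put on both sides, at a cost
  of at most \<open>M\<close>. Otherwise \<open>u\<close> is removed from the remaining relation and
  \<open>q\<close> is kept, so the cost does not accumulate.\<close>

lemma relations_remove_atom:
  assumes "finite (atoms G)"
  obtains M where "\<And>x y u. (x, y) \<in> relations \<Longrightarrow> u \<in># x \<Longrightarrow>
    \<exists>y'. (x - {#u#}, y') \<in> relations \<and> size y \<le> size y' + M"
proof -
  obtain B M where fin: "finite B" and span: "mset_pair_span B = relations"
    and B: "\<And>p q. (p, q) \<in> B \<Longrightarrow> (p, q) \<in> relations \<and> p \<noteq> {#} \<and> size q \<le> M"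
    using finite_relations_basis_bounded[OF assms] by blast
  note ind = mset_pair_span.induct[where B = B, unfolded span]
  have "\<forall>u. u \<in># x \<longrightarrow> (\<exists>y'. (x - {#u#}, y') \<in> relations \<and> size y \<le> size y' + M)"
    if "(x, y) \<in> relations" for x y
    using that
  proof (rule ind)
    fix p q x y :: "'a multiset"
    assume *: "(p, q) \<in> B" "(x, y) \<in> relations"
      and IH: "\<forall>u. u \<in># x \<longrightarrow> (\<exists>y'. (x - {#u#}, y') \<in> relations \<and> size y \<le> size y' + M)"
    have pq: "(p, q) \<in> relations" "size q \<le> M" using B[OF *(1)] by auto
    show "\<forall>u. u \<in># p + x \<longrightarrow>
      (\<exists>y'. (p + x - {#u#}, y') \<in> relations \<and> size (q + y) \<le> size y' + M)"
    proof (intro allI impI)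
      fix u assume u: "u \<in># p + x"
      show "\<exists>y'. (p + x - {#u#}, y') \<in> relations \<and> size (q + y) \<le> size y' + M"
      proof (cases "u \<in># p")
        case True
        have "set_mset (p - {#u#}) \<subseteq> atoms G"
          using pq(1) by (auto simp: relations_def dest: in_diffD)
        then have "(p - {#u#} + x, p - {#u#} + y) \<in> relations"
          using relations_add relations_refl *(2) by blast
        moreover have "p + x - {#u#} = p - {#u#} + x" using True by simp
        ultimately show ?thesis
          using pq(2) by (intro exI[of _ "p - {#u#} + y"]) simp
      next
        case False
        then have "u \<in># x" using u by simp
        then obtain y' where y': "(x - {#u#}, y') \<in> relations" "size y \<le> size y' + M"
          using IH by blast
        have "p + x - {#u#} = p + (x - {#u#})" using \<open>u \<in># x\<close> by simp
        then show ?thesis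
          using relations_add[OF pq(1) y'(1)] y'(2) by (intro exI[of _ "q + y'"]) simp
      qed
    qed
  qed simp
  then show thesis using that by blast
qed

end


section \<open>Arithmetic of finitely generated monoids\<close>

lemma SUP_ereal_Max:
  assumes "finite L" "L \<noteq> {}"
  shows "(SUP l\<in>L. ereal (real l)) = ereal (real (Max L))"
  using assms by (intro SUP_eqI) auto

lemma elasticity_set_finite:
  assumes "finite L" "L \<noteq> {}" "0 \<notin> L"
  shows "elasticity_set L = ereal (real (Max L) / real (Min L))"
proof -
  have "Min L \<noteq> 0" using assms Min_in by metis
  then show ?thesis
    using assms by (auto simp: elasticity_set_def SUP_ereal_Max cInf_eq_Min)
qed

text \<open>By \<open>finitely_generated_iff\<close> these assumptions amount to finite
  generation.\<close>

locale fg_reduced_comm_monoid = reduced_comm_monoid +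
  assumes atomic: "atomic G" and finite_atoms: "finite (atoms G)"
begin

section \<open>Finiteness of the sets of lengths\<close>

lemma factorizations_nonempty: "a \<in> carrier G \<Longrightarrow> factorizations a \<noteq> {}"
proof -
  assume "a \<in> carrier G"
  then obtain us where "set us \<subseteq> atoms G" "a = list_prod G us"
    using atomic unfolding atomic_iff_generates_atoms generates_iff by blast
  then show ?thesis using ex_list_factorization_iff[of "length us" a] by blast
qed

lemma length_set_nonempty: "a \<in> carrier G \<Longrightarrow> length_set G a \<noteq> {}"
  by (simp add: length_set_eq factorizations_nonempty)

lemma finite_length_set: "a \<in> carrier G \<Longrightarrow> finite (length_set G a)"
proof -
  assume a: "a \<in> carrier G"
  obtain M where M: "\<And>x y. (x, y) \<in> relations \<Longrightarrow> size y \<le> M * size x"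
    using relations_size_bound[OF finite_atoms] by blast
  obtain x where "x \<in> factorizations a" using factorizations_nonempty[OF a] by blast
  then have "size ` factorizations a \<subseteq> {..M * size x}"
    using M relations_iff_factorizations by blast
  then show ?thesis unfolding length_set_eq[OF a] by (rule finite_subset) simp
qed

lemma BF_monoid: "BF_monoid G"
  by (simp add: BF_monoid_def finite_length_set length_set_nonempty)

lemma zero_notin_length_set: "a \<in> carrier G \<Longrightarrow> a \<noteq> \<one> \<Longrightarrow> 0 \<notin> length_set G a"
  by (auto simp: length_set_eq factorizations_def)

lemma length_set_one: "length_set G \<one> = {0}"
  by (simp add: length_set_def)

lemma atoms_nonempty:
  assumes "carrier G \<noteq> {\<one>}"
  shows "atoms G \<noteq> {}"
proof
  assume "atoms G = {}"
  then have "a = \<one>" if "a \<in> carrier G" for a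
    using factorizations_nonempty[OF that] by (auto simp: factorizations_def)
  then show False using assms by blast
qed

text \<open>For consecutive lengths \<open>size x\<close> and \<open>size y\<close>, the
  intermediate length lemma at \<open>t = size x\<close> gives a factorization \<open>w\<close> of
  the same element with size above \<open>t\<close> and at most \<open>t + M\<close>. No length lies
  in the gap, so \<open>size y \<le> size w\<close> and the distance is at most
  \<open>M\<close>.\<close>

lemma finite_set_of_distances: "finite (set_of_distances G)"
proof -
  obtain M where M: "\<And>x y t. (x, y) \<in> relations \<Longrightarrow> size x \<le> t \<Longrightarrow> t < size y \<Longrightarrow>
    \<exists>w. (x, w) \<in> relations \<and> t < size w \<and> size w \<le> t + M"
    using relations_intermediate_length[OF finite_atoms] by blast
  have "d \<le> M" if "d \<in> set_of_distances G" for d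
  proof -
    from that obtain a where a: "a \<in> carrier G" "d \<in> distances (int ` length_set G a)"
      by (auto simp: set_of_distances_def length_system_def)
    then obtain x y where d: "d \<ge> 1" "int (size y) - int (size x) = int d"
      and xy: "x \<in> factorizations a" "y \<in> factorizations a"
      and gap: "\<not> (\<exists>m \<in> int ` length_set G a. int (size x) < m \<and> m < int (size y))"
      unfolding distances_def length_set_eq[OF a(1)] by blast
    obtain w where w: "(x, w) \<in> relations" "size x < size w" "size w \<le> size x + M"
      using M[of x y "size x"] xy d relations_iff_factorizations by auto
    have "w \<in> factorizations a"
      using w(1) xy(1) by (auto simp: relations_def factorizations_def)
    then have "\<not> size w < size y"
      using gap w(2) unfolding length_set_eq[OF a(1)] by auto
    then show ?thesis using w d by linarith
  qed
  then show ?thesis by (meson finite_nat_set_iff_bounded_le)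
qed

text \<open>For a relation \<open>(p, q)\<close> of maximal ratio, \<open>p\<close> and
  \<open>q\<close> both factor the same element \<open>a\<close>. The elasticity at \<open>a\<close>
  is thus at least this ratio, which in turn bounds the elasticity at every nonidentity
  element.\<close>

lemma maximal_elasticity_set:
  obtains L r where "L \<in> length_system G" "elasticity_set L = ereal r"
    "\<And>L'. L' \<in> length_system G \<Longrightarrow> elasticity_set L' \<le> elasticity_set L"
proof (cases "carrier G = {\<one>}")
  case True
  then have "length_system G = {{0}}" by (simp add: length_system_def length_set_one)
  then show thesis by (intro that[of "{0}" 1]) (auto simp: elasticity_set_def)
next
  case False
  obtain p q where pq: "(p, q) \<in> relations" "p \<noteq> {#}"
    "\<And>x y. (x, y) \<in> relations \<Longrightarrow> real (size y) \<le> real (size q) / real (size p) * real (size x)"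
    using relations_maximal_ratio[OF finite_atoms atoms_nonempty[OF False]] by blast
  define a where "a = mset_prod G p"
  define L where "L = length_set G a"
  have at: "set_mset p \<subseteq> atoms G" using pq(1) by (simp add: relations_def)
  then have a: "a \<in> carrier G" "a \<noteq> \<one>"
    using atoms_subset pq(2) mset_prod_eq_one_iff unfolding a_def by auto
  have eL: "elasticity_set L = ereal (real (Max L) / real (Min L))"
    unfolding L_def using a
    by (intro elasticity_set_finite finite_length_set length_set_nonempty zero_notin_length_set)
  have fin: "finite L" "L \<noteq> {}" "0 \<notin> L"
    unfolding L_def using a finite_length_set length_set_nonempty zero_notin_length_set by auto
  then have "Min L \<noteq> 0" using Min_in by metis
  have "p \<in> factorizations a" "q \<in> factorizations a"
    using pq(1) by (auto simp: factorizations_def relations_def a_def)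
  then have "size p \<in> L" "size q \<in> L" by (auto simp: L_def length_set_eq a)
  then have "real (size q) \<le> real (Max L)" "real (Min L) \<le> real (size p)"
    using fin by auto
  then have ratio: "real (size q) / real (size p) \<le> real (Max L) / real (Min L)"
    using \<open>Min L \<noteq> 0\<close> by (intro frac_le) auto
  \<comment> \<open>This settles the comparison with \<open>{0}\<close>, whose elasticity is
    \<open>1\<close> by convention.\<close>
  have "1 \<le> real (Max L) / real (Min L)"
    using fin \<open>Min L \<noteq> 0\<close> by (simp add: le_divide_eq)
  then have one: "1 \<le> elasticity_set L" by (simp add: eL one_ereal_def)
  have "elasticity_set L' \<le> elasticity_set L" if "L' \<in> length_system G" for L'
  proof -
    from that obtain b where b: "b \<in> carrier G" "L' = length_set G b"
      by (auto simp: length_system_def)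
    show ?thesis
    proof (cases "b = \<one>")
      case True
      then show ?thesis using one b by (simp add: length_set_one elasticity_set_def)
    next
      case False
      have fin': "finite L'" "L' \<noteq> {}" "0 \<notin> L'"
        using b False finite_length_set length_set_nonempty zero_notin_length_set by auto
      then have "Min L' \<noteq> 0" using Min_in by metis
      have "Max L' \<in> size ` factorizations b" "Min L' \<in> size ` factorizations b"
        using Max_in Min_in fin' unfolding b(2) length_set_eq[OF b(1)] by blast+
      then obtain x y where "x \<in> factorizations b" "y \<in> factorizations b"
        "Min L' = size x" "Max L' = size y" by blast
      then have "real (Max L') \<le> real (size q) / real (size p) * real (Min L')"
        using pq(3)[of x y] relations_iff_factorizations by auto
      then have "real (Max L') / real (Min L') \<le> real (size q) / real (size p)"
        using \<open>Min L' \<noteq> 0\<close> by (simp add: pos_divide_le_eq)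
      then show ?thesis
        using ratio fin' by (simp add: eL elasticity_set_finite)
    qed
  qed
  then show thesis using that[of L] eL a by (auto simp: L_def length_system_def)
qed

lemma elasticity_attained:
  "\<bar>elasticity G\<bar> \<noteq> \<infinity>" "\<exists>L \<in> length_system G. elasticity_set L = elasticity G"
proof -
  obtain L r where L: "L \<in> length_system G" "elasticity_set L = ereal r"
    "\<And>L'. L' \<in> length_system G \<Longrightarrow> elasticity_set L' \<le> elasticity_set L"
    using maximal_elasticity_set by blast
  have "elasticity G = elasticity_set L"
    unfolding elasticity_def using L(1,3) by (intro antisym SUP_least SUP_upper)
  then show "\<bar>elasticity G\<bar> \<noteq> \<infinity>" "\<exists>L \<in> length_system G. elasticity_set L = elasticity G"
    using L by auto
qed

lemma rho_k_eq_Max: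
  assumes "carrier G \<noteq> {\<one>}" "k \<ge> 1"
  shows "finite (union_of_length_sets G k)" "union_of_length_sets G k \<noteq> {}"
    "rho_k G k = ereal (real (Max (union_of_length_sets G k)))"
proof -
  obtain M where M: "\<And>x y. (x, y) \<in> relations \<Longrightarrow> size y \<le> M * size x"
    using relations_size_bound[OF finite_atoms] by blast
  then have "union_of_length_sets G k \<subseteq> {..M * k}"
    unfolding union_of_length_sets_eq[OF assms(1)] by auto
  then show fin: "finite (union_of_length_sets G k)" by (rule finite_subset) simp
  obtain u where "u \<in> atoms G" using atoms_nonempty[OF assms(1)] by blast
  \<comment> \<open>The trivial relation between \<open>k\<close> copies of an atom and themselves
    puts \<open>k\<close> into the union.\<close>
  then have "set_mset (replicate_mset k u) \<subseteq> atoms G" by simp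
  from relations_refl[OF this] have "size (replicate_mset k u) \<in> union_of_length_sets G k"
    unfolding union_of_length_sets_eq[OF assms(1)] using assms(2) by fastforce
  then show ne: "union_of_length_sets G k \<noteq> {}" by blast
  show "rho_k G k = ereal (real (Max (union_of_length_sets G k)))"
    unfolding rho_k_def by (rule SUP_ereal_Max[OF fin ne])
qed

text \<open>Removing one atom from the left side of a relation that realizes the maximum for
  \<open>k\<close> yields a relation for \<open>k - 1\<close> whose right side is shorter by at most
  \<open>M\<close>.\<close>

lemma rho_k_increment_bounded:
  "\<exists>M::nat. M \<ge> 1 \<and> (\<forall>k\<ge>2. rho_k G k - rho_k G (k - 1) \<le> ereal (real M))"
proof (cases "carrier G = {\<one>}")
  case True
  then have "rho_k G k = ereal (real k)" for k
    by (simp add: rho_k_def union_of_length_sets_def Units_eq)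
  then show ?thesis by (intro exI[of _ 1]) auto
next
  case False
  obtain M where M: "\<And>x y u. (x, y) \<in> relations \<Longrightarrow> u \<in># x \<Longrightarrow>
      \<exists>y'. (x - {#u#}, y') \<in> relations \<and> size y \<le> size y' + M"
    using relations_remove_atom[OF finite_atoms] by blast
  \<comment> \<open>The successor ensures that the bound is positive.\<close>
  have "rho_k G k - rho_k G (k - 1) \<le> ereal (real (Suc M))" if k: "k \<ge> 2" for k
  proof -
    let ?U = "union_of_length_sets G"
    have k1: "k \<ge> 1" "k - 1 \<ge> 1" using k by auto
    note U = rho_k_eq_Max[OF False k1(1)] and U' = rho_k_eq_Max[OF False k1(2)]
    have "Max (?U k) \<in> ?U k" using U by simp
    then obtain x y where xy: "(x, y) \<in> relations" "size x = k" "Max (?U k) = size y"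
      unfolding union_of_length_sets_eq[OF False] by blast
    then obtain u where u: "u \<in># x" using k by fastforce
    then obtain y' where y': "(x - {#u#}, y') \<in> relations" "size y \<le> size y' + M"
      using M xy by blast
    have s: "size (x - {#u#}) = k - 1" using u xy by (simp add: size_Diff_singleton)
    \<comment> \<open>Since \<open>k \<ge> 2\<close>, an atom remains on the left, so
      \<open>y'\<close> is nonempty, as membership in the union for \<open>k - 1\<close>
      requires.\<close>
    then have "x - {#u#} \<noteq> {#}" using k1(2) by (metis not_one_le_zero size_empty)
    then have "y' \<noteq> {#}" using relations_empty_iff y'(1) by blast
    then have "size y' \<in> ?U (k - 1)"
      unfolding union_of_length_sets_eq[OF False] using y'(1) s by blast
    then have "size y' \<le> Max (?U (k - 1))" using U' by simp
    then have "Max (?U k) \<le> Max (?U (k - 1)) + M" using xy y' by simp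
    then show ?thesis unfolding U(3) U'(3) by simp
  qed
  then show ?thesis by (intro exI[of _ "Suc M"]) simp
qed

end

theorem proposition2p8:
  fixes H :: "('a, 'b) monoid_scheme"
  assumes "comm_monoid_cancel H" and "reduced H"
  shows "(\<forall>A. A \<subseteq> atoms H \<longrightarrow>
            ((atomic H \<and> A = atoms H) \<longleftrightarrow> smallest_generating_set H A) \<and>
            (smallest_generating_set H A \<longleftrightarrow> minimal_generating_set H A))
       \<and> (finitely_generated H \<longleftrightarrow> atomic H \<and> finite (atoms H))
       \<and> (finitely_generated H \<longrightarrow>
            BF_monoid H \<and> finite (set_of_distances H) \<and> \<bar>elasticity H\<bar> \<noteq> \<infinity> \<and>
            (\<exists>L \<in> length_system H. elasticity_set L = elasticity H) \<and>
            (\<exists>M::nat. M \<ge> 1 \<and> (\<forall>k\<ge>2. rho_k H k - rho_k H (k - 1) \<le> ereal (real M))))"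
proof -
  interpret reduced_comm_monoid H
    using assms by (intro reduced_comm_monoid.intro reduced_comm_monoid_axioms.intro)
  have "BF_monoid H \<and> finite (set_of_distances H) \<and> \<bar>elasticity H\<bar> \<noteq> \<infinity> \<and>
      (\<exists>L \<in> length_system H. elasticity_set L = elasticity H) \<and>
      (\<exists>M::nat. M \<ge> 1 \<and> (\<forall>k\<ge>2. rho_k H k - rho_k H (k - 1) \<le> ereal (real M)))"
    if "finitely_generated H"
  proof -
    interpret fg_reduced_comm_monoid H
      using that finitely_generated_iff by unfold_locales auto
    show ?thesis
      using BF_monoid finite_set_of_distances elasticity_attained rho_k_increment_bounded by blast
  qed
  then show ?thesis
    using smallest_generating_set_iff minimal_generating_set_iff finitely_generated_iff by blast
qed

end
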